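(* Let $\Delta$ be an extremal simplicial complex; that is, $\Delta$ is a pure simplicial complex of some dimension $d$ with $n$ facets, and $\Delta$ has the least possible number of $(d-1)$-dimensional faces among all simplicial complexes with exactly $n$ faces of dimension $d$. Then $\Delta$ is vertex decomposable.
   Context: Simplicial complexes are finite (abstract) simplicial complexes. The empty set counts as a face, of dimension $-1$; a face with $k$ elements has dimension $k-1$. A simplicial complex is pure if all its facets (inclusion-maximal faces) have the same dimension. Extremal: a pure simplicial complex $\Delta$ of dimension $d$ with $n$ facets is called extremal if it has the least possible number of $(d-1)$-dimensional faces among all simplicial complexes (not necessarily pure, on any vertex set) with $n$ faces of dimension $d$. In particular, every zero-dimensional complex is extremal, since each has exactly one $(-1)$-dimensional face, the empty set. Link and deletion: for a vertex $x$ of $\Delta$, $\operatorname{lk}_{\Delta}\{x\}=\{\tau\in\Delta : x\notin\tau \text{ and } \tau\cup\{x\}\in\Delta\}$ and $\Delta\setminus x=\{\tau\in\Delta : x\notin\tau\}$. Vertex decomposable (recursive definition): a pure simplicial complex $\Delta$ is vertex decomposable if one of the following holds: (1) $\Delta$ is empty (i.e. it has no vertices, $\Delta=\{\emptyset\}$); (2) $\Delta$ is a single vertex; (3) for some vertex $x$ of $\Delta$, both $\operatorname{lk}_{\Delta}\{x\}$ and $\Delta\setminus x$ are pure and vertex decomposable. *)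

theory Defs
  imports Main
begin

definition simplicial_complex :: "'a set set \<Rightarrow> bool" where
  "simplicial_complex \<Delta> \<longleftrightarrow>
     finite \<Delta> \<and> (\<forall>\<tau>\<in>\<Delta>. finite \<tau>) \<and> {} \<in> \<Delta> \<and>
     (\<forall>\<tau>\<in>\<Delta>. \<forall>\<sigma>. \<sigma> \<subseteq> \<tau> \<longrightarrow> \<sigma> \<in> \<Delta>)"

text \<open>Dimensions are integers: the empty face has dimension -1, and a complex has no
  faces of dimension -2.\<close>

definition face_dim :: "'a set \<Rightarrow> int" where
  "face_dim \<tau> = int (card \<tau>) - 1"

definition faces_of_dim :: "int \<Rightarrow> 'a set set \<Rightarrow> 'a set set" where
  "faces_of_dim k \<Delta> = {\<tau> \<in> \<Delta>. face_dim \<tau> = k}"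

definition complex_dim :: "'a set set \<Rightarrow> int" where
  "complex_dim \<Delta> = Max (face_dim ` \<Delta>)"

definition facets :: "'a set set \<Rightarrow> 'a set set" where
  "facets \<Delta> = {\<tau> \<in> \<Delta>. \<forall>\<sigma>\<in>\<Delta>. \<tau> \<subseteq> \<sigma> \<longrightarrow> \<sigma> = \<tau>}"

definition pure :: "'a set set \<Rightarrow> bool" where
  "pure \<Delta> \<longleftrightarrow> (\<forall>\<sigma>\<in>facets \<Delta>. \<forall>\<tau>\<in>facets \<Delta>. face_dim \<sigma> = face_dim \<tau>)"

text \<open>The competitors \<open>\<Gamma>\<close> may live on any vertex set. Every finite complex is isomorphic
  to one whose vertices are natural numbers, so \<open>\<Gamma>\<close> ranges over complexes on \<open>nat\<close>.
  Ranging over the vertex type of \<open>\<Delta>\<close> would lose competitors when that type is finite.\<close>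

definition extremal :: "'a set set \<Rightarrow> bool" where
  "extremal \<Delta> \<longleftrightarrow>
     simplicial_complex \<Delta> \<and> pure \<Delta> \<and>
     (let d = complex_dim \<Delta>; n = card (facets \<Delta>) in
       \<forall>\<Gamma> :: nat set set. simplicial_complex \<Gamma> \<and> card (faces_of_dim d \<Gamma>) = n \<longrightarrow>
         card (faces_of_dim (d - 1) \<Delta>) \<le> card (faces_of_dim (d - 1) \<Gamma>))"

definition vertices :: "'a set set \<Rightarrow> 'a set" where
  "vertices \<Delta> = {x. {x} \<in> \<Delta>}"

definition link :: "'a set set \<Rightarrow> 'a \<Rightarrow> 'a set set" where
  "link \<Delta> x = {\<tau> \<in> \<Delta>. x \<notin> \<tau> \<and> \<tau> \<union> {x} \<in> \<Delta>}"

definition deletion :: "'a set set \<Rightarrow> 'a \<Rightarrow> 'a set set" where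
  "deletion \<Delta> x = {\<tau> \<in> \<Delta>. x \<notin> \<tau>}"

inductive vertex_decomposable :: "'a set set \<Rightarrow> bool" where
  empty: "vertex_decomposable {{}}"
| single_vertex: "vertex_decomposable {{}, {v}}"
| decompose:
    "\<lbrakk> simplicial_complex \<Delta>; pure \<Delta>; x \<in> vertices \<Delta>;
       pure (link \<Delta> x); vertex_decomposable (link \<Delta> x);
       pure (deletion \<Delta> x); vertex_decomposable (deletion \<Delta> x) \<rbrakk>
     \<Longrightarrow> vertex_decomposable \<Delta>"

end

theory Submission
  imports Defs "HOL-Library.Nat_Bijection"
begin

text \<open>
  The facets of an extremal complex form a uniform family \<open>F\<close> of minimal shadow. Choose a vertex
  \<open>x\<close> of at most average degree \<open>t\<close>, and let \<open>L\<close> be its link and \<open>D\<close> its deletion in \<open>F\<close>. If \<open>F\<close>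
  has \<open>v\<close> vertices, the colexicographic initial segment \<open>C\<close> of size \<open>\<bar>D\<bar>\<close> lives on \<open>v - 1\<close>
  vertices, so the local LYM inequality gives \<open>t \<le> \<bar>\<partial>C\<bar>\<close>. Hence the initial segment \<open>T\<close> of size
  \<open>t\<close> one level below lies in \<open>\<partial>C\<close>, and \<open>C\<close> together with the cone over \<open>T\<close> from a new vertex
  is a competitor of \<open>F\<close> with shadow of size \<open>\<bar>\<partial>T\<bar> + \<bar>\<partial>C\<bar>\<close>. Minimality of \<open>F\<close> and the
  Kruskal--Katona theorem for \<open>L\<close> and \<open>D\<close> yield
  \<open>\<bar>\<partial>L\<bar> + \<bar>L \<union> \<partial>D\<bar> = \<bar>\<partial>F\<bar> \<le> \<bar>\<partial>T\<bar> + \<bar>\<partial>C\<bar> \<le> \<bar>\<partial>L\<bar> + \<bar>\<partial>D\<bar>\<close>. So \<open>L \<subseteq> \<partial>D\<close>, which makes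
  the deletion pure with facets \<open>D\<close>, and both \<open>L\<close> and \<open>D\<close> have minimal shadow again.

  The Kruskal--Katona theorem follows Frankl's argument: after shifting towards a vertex \<open>z\<close>, the
  shadow of \<open>F\<close> is counted by the link of \<open>z\<close> and its shadow, and the same holds for an initial
  segment and its least vertex.
\<close>

section \<open>Shadows of uniform families\<close>

definition uniform :: "nat \<Rightarrow> 'a set set \<Rightarrow> bool" where
  "uniform k F \<longleftrightarrow> finite F \<and> (\<forall>A\<in>F. finite A \<and> card A = k)"

definition shadow :: "'a set set \<Rightarrow> 'a set set" where
  "shadow F = {B. \<exists>a. a \<notin> B \<and> insert a B \<in> F}"

definition link_fam :: "'a \<Rightarrow> 'a set set \<Rightarrow> 'a set set" where
  "link_fam x F = {B. x \<notin> B \<and> insert x B \<in> F}"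

definition del_fam :: "'a \<Rightarrow> 'a set set \<Rightarrow> 'a set set" where
  "del_fam x F = {A \<in> F. x \<notin> A}"

lemma shadowI: "A \<in> F \<Longrightarrow> a \<in> A \<Longrightarrow> A - {a} \<in> shadow F"
  unfolding shadow_def by (auto simp: insert_absorb)

text \<open>Truncated subtraction is harmless at \<open>k = 0\<close>, where the shadow is
  empty.\<close>

lemma uniform_shadow:
  assumes "uniform k F"
  shows "uniform (k - 1) (shadow F)"
proof -
  have "shadow F \<subseteq> (\<Union>A\<in>F. Pow A)"
    unfolding shadow_def by blast
  moreover have "finite (\<Union>A\<in>F. Pow A)"
    using assms by (auto simp: uniform_def)
  ultimately have "finite (shadow F)"
    by (rule finite_subset)
  moreover have "finite B \<and> card B = k - 1" if "B \<in> shadow F" for B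
    using that assms unfolding shadow_def uniform_def by force
  ultimately show ?thesis
    unfolding uniform_def by blast
qed

lemma finite_shadow: "uniform k F \<Longrightarrow> finite (shadow F)"
  using uniform_shadow uniform_def by blast

lemma shadow_uniform_0: "uniform 0 F \<Longrightarrow> shadow F = {}"
  unfolding uniform_def shadow_def by fastforce

lemma shadow_nonempty:
  assumes "uniform (Suc k) F" and "F \<noteq> {}"
  shows "shadow F \<noteq> {}"
proof -
  obtain A where A: "A \<in> F" using assms(2) by blast
  then have "A \<noteq> {}" using assms(1) by (force simp: uniform_def)
  then show ?thesis using shadowI[OF A] by blast
qed

lemma uniform_subset: "uniform k F \<Longrightarrow> G \<subseteq> F \<Longrightarrow> uniform k G"
  unfolding uniform_def using finite_subset by blast

lemma uniform_del_fam: "uniform k F \<Longrightarrow> uniform k (del_fam x F)"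
  by (rule uniform_subset) (auto simp: del_fam_def)

lemma insert_link_fam: "insert x ` link_fam x F = {A \<in> F. x \<in> A}"
proof
  show "{A \<in> F. x \<in> A} \<subseteq> insert x ` link_fam x F"
  proof
    fix A assume "A \<in> {A \<in> F. x \<in> A}"
    then have "A - {x} \<in> link_fam x F" "A = insert x (A - {x})"
      by (auto simp: link_fam_def insert_absorb)
    then show "A \<in> insert x ` link_fam x F" by blast
  qed
qed (auto simp: link_fam_def)

lemma inj_on_insert: "\<forall>B\<in>F. x \<notin> B \<Longrightarrow> inj_on (insert x) F"
  by (rule inj_onI) (metis insert_ident)

lemma inj_on_insert_link_fam: "inj_on (insert x) (link_fam x F)"
  by (rule inj_on_insert) (auto simp: link_fam_def)

lemma uniform_link_fam:
  assumes "uniform (Suc k) F"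
  shows "uniform k (link_fam x F)"
proof -
  have "finite (insert x ` link_fam x F)"
    unfolding insert_link_fam using assms by (simp add: uniform_def)
  then have "finite (link_fam x F)"
    using inj_on_insert_link_fam by (rule finite_imageD)
  moreover have "finite B \<and> card B = k" if "B \<in> link_fam x F" for B
    using that assms unfolding link_fam_def uniform_def by force
  ultimately show ?thesis
    by (auto simp: uniform_def)
qed

lemma card_link_fam: "card (link_fam x F) = card {A \<in> F. x \<in> A}"
  using card_image[OF inj_on_insert_link_fam, of x F] by (simp add: insert_link_fam)

lemma card_link_del:
  assumes "finite F"
  shows "card F = card (link_fam x F) + card (del_fam x F)"
proof -
  have "F = {A \<in> F. x \<in> A} \<union> del_fam x F" "{A \<in> F. x \<in> A} \<inter> del_fam x F = {}"
    by (auto simp: del_fam_def)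
  then show ?thesis
    using assms card_Un_disjoint[of "{A \<in> F. x \<in> A}" "del_fam x F"]
    unfolding card_link_fam by (simp add: del_fam_def)
qed

lemma link_fam_shadow: "link_fam x (shadow F) = shadow (link_fam x F)"
  unfolding link_fam_def shadow_def by (auto simp: insert_commute)

lemma del_fam_shadow: "del_fam x (shadow F) = link_fam x F \<union> shadow (del_fam x F)"
  unfolding link_fam_def shadow_def del_fam_def by auto

text \<open>Shadow sets containing \<open>x\<close> come from the link alone; those avoiding
  \<open>x\<close> arise by removing \<open>x\<close> itself or by removing an element from a set
  without \<open>x\<close>.\<close>

lemma card_shadow_split:
  assumes "uniform k F"
  shows "card (shadow F)
    = card (shadow (link_fam x F)) + card (link_fam x F \<union> shadow (del_fam x F))"
  using card_link_del[OF finite_shadow[OF assms], of x]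
  by (simp add: link_fam_shadow del_fam_shadow)

section \<open>Shifting\<close>

text \<open>The shifting operator of extremal set theory. A set stays put when its image is already
  present, which keeps the map injective.\<close>

definition shift :: "'a \<Rightarrow> 'a \<Rightarrow> 'a set set \<Rightarrow> 'a set set" where
  "shift z j F = (\<lambda>A. if j \<in> A \<and> z \<notin> A \<and> insert z (A - {j}) \<notin> F
     then insert z (A - {j}) else A) ` F"

lemma card_shift: "card (shift z j F) = card F"
  unfolding shift_def
proof (rule card_image, rule inj_onI)
  fix A B
  assume "A \<in> F" "B \<in> F"
    and eq: "(if j \<in> A \<and> z \<notin> A \<and> insert z (A - {j}) \<notin> F then insert z (A - {j}) else A)
      = (if j \<in> B \<and> z \<notin> B \<and> insert z (B - {j}) \<notin> F then insert z (B - {j}) else B)"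
  then show "A = B"
    by (auto split: if_splits)
qed

lemma uniform_shift:
  assumes "uniform k F"
  shows "uniform k (shift z j F)"
proof -
  have "card (insert z (A - {j})) = card A" if "finite A" "j \<in> A" "z \<notin> A" for A
    using that by (metis Diff_iff card_Suc_Diff1 card_insert_disjoint finite_Diff)
  then show ?thesis
    using assms unfolding uniform_def shift_def by auto
qed

text \<open>Sets pair up by exchanging \<open>j\<close> for \<open>z\<close>, and a shift acts on
  each pair separately: a lone member becomes the one with \<open>z\<close>, a full pair
  stays.\<close>

lemma mem_shift:
  assumes "z \<noteq> j"
  shows "A \<in> shift z j F \<longleftrightarrow>
    (if z \<in> A \<and> j \<notin> A then A \<in> F \<or> insert j (A - {z}) \<in> F
     else if j \<in> A \<and> z \<notin> A then A \<in> F \<and> insert z (A - {j}) \<in> F else A \<in> F)"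
    (is "_ \<longleftrightarrow> ?R")
proof
  assume "A \<in> shift z j F"
  then obtain B where B: "B \<in> F" and A: "A = (if j \<in> B \<and> z \<notin> B \<and> insert z (B - {j}) \<notin> F
     then insert z (B - {j}) else B)" unfolding shift_def by blast
  show ?R
  proof (cases "j \<in> B \<and> z \<notin> B \<and> insert z (B - {j}) \<notin> F")
    case True
    then have "insert j (A - {z}) = B" using A by auto
    then show ?thesis using True A B assms by auto
  next
    case False
    then show ?thesis using A B by auto
  qed
next
  assume R: ?R
  show "A \<in> shift z j F"
  proof (cases "z \<in> A \<and> j \<notin> A \<and> A \<notin> F")
    case True
    let ?B = "insert j (A - {z})"
    have "?B \<in> F" using R True by auto
    moreover have "insert z (?B - {j}) = A" using True by auto
    ultimately show ?thesis using True assms unfolding shift_def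
      by (intro image_eqI[of _ _ ?B]) auto
  next
    case False
    then show ?thesis using R unfolding shift_def
      by (intro image_eqI[of _ _ A]) (auto split: if_splits)
  qed
qed

lemma shadow_shift:
  assumes "z \<noteq> j"
  shows "shadow (shift z j F) \<subseteq> shift z j (shadow F)"
proof
  fix B assume "B \<in> shadow (shift z j F)"
  then obtain a where a: "a \<notin> B" and mem: "insert a B \<in> shift z j F"
    unfolding shadow_def by blast
  let ?A = "insert a B"
  consider "z \<in> B" "j \<in> B" | "z \<notin> B" "j \<notin> B" | "z \<in> B" "j \<notin> B" | "z \<notin> B" "j \<in> B"
    by blast
  then show "B \<in> shift z j (shadow F)"
  proof cases
    case 1
    then show ?thesis using a mem assms by (auto simp: mem_shift shadow_def)
  next
    case 2
    have "a = z \<Longrightarrow> insert j (?A - {z}) = insert j B" using 2 by auto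
    then show ?thesis using 2 a mem assms
      by (auto simp: mem_shift shadow_def split: if_splits)
  next
    case 3
    have "B \<in> shadow F \<or> insert j (B - {z}) \<in> shadow F"
    proof (cases "?A \<in> F")
      case True
      then show ?thesis using a by (auto simp: shadow_def)
    next
      case False
      then have "insert j (?A - {z}) \<in> F" "a \<noteq> j"
        using mem 3 assms by (auto simp: mem_shift split: if_splits)
      moreover have "insert j (?A - {z}) = insert a (insert j (B - {z}))" using a 3 by auto
      ultimately show ?thesis using a by (auto simp: shadow_def)
    qed
    then show ?thesis using 3 assms by (simp add: mem_shift)
  next
    case 4
    have A: "?A \<in> F"
      using mem 4 assms by (auto simp: mem_shift split: if_splits)
    \<comment> \<open>As \<open>B\<close> contains \<open>j\<close> but not \<open>z\<close>, both
      \<open>B\<close> and its partner must be found in \<open>shadow F\<close>; in the previous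
      case one of the two suffices.\<close>
    have "insert z (B - {j}) \<in> shadow F"
    proof (cases "a = z")
      case True
      then have "insert z (B - {j}) = ?A - {j}" using assms by auto
      then show ?thesis using shadowI[OF A, of j] 4 by simp
    next
      case False
      then have "insert z (?A - {j}) \<in> F"
        using mem 4 assms by (auto simp: mem_shift split: if_splits)
      moreover have "insert z (?A - {j}) = insert a (insert z (B - {j}))" using a 4 by auto
      ultimately show ?thesis using a False by (auto simp: shadow_def)
    qed
    then show ?thesis using 4 A a assms by (auto simp: mem_shift shadow_def)
  qed
qed

lemma card_shadow_shift:
  assumes "uniform k F" and "z \<noteq> j"
  shows "card (shadow (shift z j F)) \<le> card (shadow F)"
proof -
  have "finite (shift z j (shadow F))"
    using finite_shadow[OF assms(1)] by (simp add: shift_def)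
  then show ?thesis
    using card_mono[OF _ shadow_shift[OF assms(2)]] by (metis card_shift)
qed

text \<open>Each violation of the last inclusion supplies a \<open>j\<close> whose shift towards
  \<open>z\<close> strictly shrinks the deletion of \<open>z\<close>, so finitely many shifts
  suffice.\<close>

lemma exists_shifted:
  fixes z :: 'a and F :: "'a set set"
  assumes "uniform k F"
  obtains G where "uniform k G" "card G = card F" "card (shadow G) \<le> card (shadow F)"
    "shadow (del_fam z G) \<subseteq> link_fam z G"
proof -
  have "\<exists>G. uniform k G \<and> card G = card F \<and> card (shadow G) \<le> card (shadow F)
    \<and> shadow (del_fam z G) \<subseteq> link_fam z G"
    using assms
  proof (induction "card (del_fam z F)" arbitrary: F rule: less_induct)
    case less
    show ?case
    proof (cases "shadow (del_fam z F) \<subseteq> link_fam z F")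
      case True
      then show ?thesis using less.prems by blast
    next
      case False
      then obtain B j where Bj: "j \<notin> B" "insert j B \<in> F" "z \<notin> insert j B" "insert z B \<notin> F"
        by (auto simp: shadow_def del_fam_def link_fam_def)
      then have zj: "z \<noteq> j" by auto
      have "insert z (insert j B - {j}) = insert z B" using Bj by auto
      then have "insert j B \<notin> shift z j F"
        using Bj zj by (auto simp: mem_shift)
      moreover have "del_fam z (shift z j F) \<subseteq> del_fam z F"
        using zj by (auto simp: del_fam_def mem_shift split: if_splits)
      ultimately have "del_fam z (shift z j F) \<subset> del_fam z F"
        using Bj by (auto simp: del_fam_def)
      moreover have "finite (del_fam z F)"
        using less.prems by (simp add: del_fam_def uniform_def)
      ultimately have "card (del_fam z (shift z j F)) < card (del_fam z F)"
        by (rule psubset_card_mono[rotated])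
      from less.hyps[OF this uniform_shift[OF less.prems]]
      show ?thesis
        using card_shadow_shift[OF less.prems zj] by (metis card_shift le_trans)
    qed
  qed
  then show ?thesis using that by blast
qed

section \<open>The colexicographic order\<close>

text \<open>\<open>set_encode\<close> maps a set to the sum of the powers \<open>2 ^ i\<close> of its elements, so comparing
  codes is comparing sets in the colexicographic order.\<close>

lemma set_encode_below:
  assumes "A \<subseteq> {..<e}"
  shows "set_encode A < 2 ^ e"
proof -
  have "set_encode A \<le> set_encode {..<e}"
    unfolding set_encode_def using assms by (intro sum_mono2) auto
  also have "\<dots> < 2 ^ e"
    by (simp add: set_encode_def lessThan_atLeast0 sum_power2)
  finally show ?thesis .
qed

lemma set_encode_split:
  assumes "finite A"
  shows "set_encode A = set_encode {i\<in>A. e < i} + (if e \<in> A then 2 ^ e else 0)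
    + set_encode {i\<in>A. i < e}"
proof -
  have "A = {i\<in>A. e < i} \<union> ({i\<in>A. i = e} \<union> {i\<in>A. i < e})" by auto
  then have "set_encode A = sum ((^) 2) ({i\<in>A. e < i} \<union> ({i\<in>A. i = e} \<union> {i\<in>A. i < e}))"
    unfolding set_encode_def by simp
  also have "\<dots> = set_encode {i\<in>A. e < i} + (sum ((^) 2) {i\<in>A. i = e} + set_encode {i\<in>A. i < e})"
    unfolding set_encode_def using assms by (subst sum.union_disjoint; auto)+
  also have "{i\<in>A. i = e} = (if e \<in> A then {e} else {})" by auto
  finally show ?thesis by simp
qed

text \<open>All elements below \<open>e\<close> together contribute less than \<open>2 ^ e\<close>,
  so the highest position where the sets differ decides.\<close>

lemma set_encode_lessI:
  assumes "finite A" "finite B" "e \<in> B" "e \<notin> A" "\<And>i. e < i \<Longrightarrow> i \<in> A \<longleftrightarrow> i \<in> B"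
  shows "set_encode A < set_encode B"
proof -
  have eq: "{i\<in>A. e < i} = {i\<in>B. e < i}" using assms(5) by auto
  have "set_encode {i\<in>A. i < e} < 2 ^ e" by (rule set_encode_below) auto
  then show ?thesis
    using set_encode_split[OF assms(1), of e] set_encode_split[OF assms(2), of e] assms(3,4)
    by (simp add: eq)
qed

lemma set_encode_lessE:
  assumes "finite A" "finite B" "set_encode A < set_encode B"
  obtains e where "e \<in> B" "e \<notin> A" "\<And>i. e < i \<Longrightarrow> i \<in> A \<longleftrightarrow> i \<in> B"
proof -
  let ?S = "(A - B) \<union> (B - A)"
  define e where "e = Max ?S"
  have "?S \<noteq> {}" using assms(3) by auto
  then have e: "e \<in> ?S" unfolding e_def using assms(1,2) by (intro Max_in) auto
  have above: "i \<in> A \<longleftrightarrow> i \<in> B" if "e < i" for i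
  proof (rule ccontr)
    assume "(i \<in> A) \<noteq> (i \<in> B)"
    then have "i \<in> ?S" by auto
    then have "i \<le> e" unfolding e_def using assms(1,2) by (intro Max_ge) auto
    then show False using that by simp
  qed
  have "e \<notin> A"
  proof
    assume "e \<in> A"
    then have "set_encode B < set_encode A"
      using e above assms(1,2) by (intro set_encode_lessI[of B A e]) auto
    then show False using assms(3) by simp
  qed
  then show ?thesis using that e above by blast
qed

lemma set_encode_insert_gt: "finite A \<Longrightarrow> a \<notin> A \<Longrightarrow> set_encode A < set_encode (insert a A)"
  by (rule set_encode_lessI[of _ _ a]) auto

text \<open>With the lower bound \<open>m\<close>, the link and deletion of an initial segment at
  \<open>m\<close> are again initial segments, with lower bound \<open>Suc m\<close>.\<close>

definition level :: "nat \<Rightarrow> nat \<Rightarrow> nat set set" where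
  "level m k = {A. finite A \<and> A \<subseteq> {m..} \<and> card A = k}"

definition colex_init :: "nat \<Rightarrow> nat \<Rightarrow> nat set set \<Rightarrow> bool" where
  "colex_init m k C \<longleftrightarrow> finite C \<and> C \<subseteq> level m k \<and>
     (\<forall>A\<in>C. \<forall>B\<in>level m k. set_encode B < set_encode A \<longrightarrow> B \<in> C)"

text \<open>The completion of \<open>B\<close> by the least available element is the colexicographically least
  set of its size above \<open>B\<close>.\<close>

lemma set_encode_insert_least:
  assumes B: "finite B" "B \<subseteq> {m..}" and D: "finite D" "D \<subseteq> {m..}" "card D = Suc (card B)"
    and less: "set_encode B < set_encode D"
    and b: "m \<le> b" "b \<notin> B" "\<And>i. m \<le> i \<Longrightarrow> i < b \<Longrightarrow> i \<in> B"
  shows "set_encode (insert b B) \<le> set_encode D"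
proof -
  obtain e where e: "e \<in> D" "e \<notin> B" "\<And>i. e < i \<Longrightarrow> i \<in> B \<longleftrightarrow> i \<in> D"
    using set_encode_lessE[OF B(1) D(1) less] by blast
  have "b \<le> e" using e b(3)[of e] D(2) by (meson atLeast_iff leI subsetD)
  show ?thesis
  proof (cases "b = e")
    case False
    then have "set_encode (insert b B) < set_encode D"
      using e \<open>b \<le> e\<close> B D by (intro set_encode_lessI[of _ _ e]) auto
    then show ?thesis by simp
  next
    case True
    have "D \<subseteq> insert b B"
    proof
      fix i assume "i \<in> D"
      then show "i \<in> insert b B"
        using e(3)[of i] b(3)[of i] D(2) True by (cases i b rule: linorder_cases) auto
    qed
    then have "D = insert b B"
      using D(3) B(1) b(2) by (intro card_subset_eq) auto
    then show ?thesis by simp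
  qed
qed

lemma exists_least_missing:
  assumes "finite (B :: nat set)"
  obtains b where "m \<le> b" "b \<notin> B" "\<And>i. m \<le> i \<Longrightarrow> i < b \<Longrightarrow> i \<in> B"
proof -
  have "infinite ({m..} - B)" using assms by (simp add: infinite_Ici)
  then have ex: "\<exists>b. m \<le> b \<and> b \<notin> B" by (metis Diff_iff atLeast_iff ex_in_conv infinite_imp_nonempty)
  show ?thesis
    using that[of "LEAST b. m \<le> b \<and> b \<notin> B"] LeastI_ex[OF ex] not_less_Least[of _ "\<lambda>b. m \<le> b \<and> b \<notin> B"]
    by blast
qed

lemma colex_init_uniform: "colex_init m k C \<Longrightarrow> uniform k C"
  unfolding colex_init_def uniform_def level_def by blast

lemma colex_init_mem:
  assumes "colex_init m k C" "A \<in> C" "B \<in> level m k" "set_encode B \<le> set_encode A"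
  shows "B \<in> C"
proof (cases "set_encode B = set_encode A")
  case True
  moreover have "finite A" "finite B" using assms by (auto simp: colex_init_def level_def)
  ultimately have "A = B" using set_encode_eq by blast
  then show ?thesis using assms by simp
next
  case False
  then show ?thesis using assms unfolding colex_init_def by auto
qed

text \<open>If \<open>insert a B\<close> lies in \<open>C\<close> and \<open>B'\<close> precedes
  \<open>B\<close>, then \<open>B'\<close> completed by its least missing element does not come
  after \<open>insert a B\<close>, hence lies in \<open>C\<close>.\<close>

lemma colex_init_shadow:
  assumes C: "colex_init m (Suc k) C"
  shows "colex_init m k (shadow C)"
  unfolding colex_init_def
proof (intro conjI ballI impI)
  have U: "uniform (Suc k) C" using C by (rule colex_init_uniform)
  show "finite (shadow C)" using U by (rule finite_shadow)
  show lev: "shadow C \<subseteq> level m k"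
  proof
    fix B assume "B \<in> shadow C"
    then obtain a where "a \<notin> B" "insert a B \<in> C" by (auto simp: shadow_def)
    moreover have "insert a B \<in> level m (Suc k)" using C calculation by (auto simp: colex_init_def)
    ultimately show "B \<in> level m k" by (auto simp: level_def)
  qed
  fix B B' assume B: "B \<in> shadow C" and B': "B' \<in> level m k" "set_encode B' < set_encode B"
  obtain a where a: "a \<notin> B" "insert a B \<in> C" using B by (auto simp: shadow_def)
  have fin: "finite B" "finite B'" using lev B B' by (auto simp: level_def)
  obtain b where b: "m \<le> b" "b \<notin> B'" "\<And>i. m \<le> i \<Longrightarrow> i < b \<Longrightarrow> i \<in> B'"
    using exists_least_missing[OF fin(2)] by blast
  have A: "insert a B \<in> level m (Suc k)" using C a by (auto simp: colex_init_def)
  have "set_encode (insert b B') \<le> set_encode (insert a B)"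
  proof (rule set_encode_insert_least[of _ m])
    show "set_encode B' < set_encode (insert a B)"
      using B'(2) set_encode_insert_gt[OF fin(1) a(1)] by simp
  qed (use A B' b in \<open>auto simp: level_def\<close>)
  moreover have "insert b B' \<in> level m (Suc k)" using B' b by (auto simp: level_def)
  ultimately have "insert b B' \<in> C" using colex_init_mem[OF C a(2)] by blast
  then show "B' \<in> shadow C" using b by (auto simp: shadow_def)
qed

text \<open>Codes order each level linearly, so its initial segments form a chain under
  inclusion.\<close>

lemma colex_init_mono:
  assumes C: "colex_init m k C" and D: "colex_init m k D" and le: "card C \<le> card D"
  shows "C \<subseteq> D"
proof (rule ccontr)
  assume "\<not> C \<subseteq> D"
  then obtain A where A: "A \<in> C" "A \<notin> D" by blast
  have "D \<subseteq> C"
  proof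
    fix B assume B: "B \<in> D"
    have "A \<in> level m k" "B \<in> level m k" using A B C D by (auto simp: colex_init_def)
    then show "B \<in> C"
      using colex_init_mem[OF C A(1), of B] colex_init_mem[OF D B, of A] A(2) by fastforce
  qed
  then have "D \<subset> C" using A by blast
  then have "card D < card C" using C by (intro psubset_card_mono) (auto simp: colex_init_def)
  then show False using le by simp
qed

lemma infinite_level: "infinite (level m (Suc k))"
proof
  assume "finite (level m (Suc k))"
  moreover have "(\<lambda>i. {i..i + k}) ` {m..} \<subseteq> level m (Suc k)"
    by (auto simp: level_def)
  ultimately have "finite ((\<lambda>i. {i..i + k}) ` {m..})" by (rule finite_subset[rotated])
  moreover have "inj_on (\<lambda>i. {i..i + k}) {m..}"
    by (rule inj_onI) (simp add: Icc_eq_Icc)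
  ultimately show False using finite_imageD infinite_Ici by blast
qed

lemma colex_init_extend:
  assumes C: "colex_init m (Suc k) C"
  obtains D where "D \<in> level m (Suc k)" "D \<notin> C" "colex_init m (Suc k) (insert D C)"
proof -
  let ?L = "level m (Suc k) - C"
  have "infinite ?L" using C infinite_level by (simp add: colex_init_def)
  then obtain D0 where "D0 \<in> ?L" using infinite_imp_nonempty by blast
  from ex_has_least_nat[of "\<lambda>D. D \<in> ?L", OF this, of set_encode]
  obtain D where D: "D \<in> ?L" "\<And>E. E \<in> ?L \<Longrightarrow> set_encode D \<le> set_encode E" by blast
  have "colex_init m (Suc k) (insert D C)"
    using C D unfolding colex_init_def by (auto simp: not_le[symmetric])
  then show ?thesis using that D by blast
qed

lemma colex_init_exists: "\<exists>C. colex_init m (Suc k) C \<and> card C = n"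
proof (induction n)
  case 0
  have "colex_init m (Suc k) {}" by (simp add: colex_init_def)
  then show ?case by force
next
  case (Suc n)
  then obtain C where C: "colex_init m (Suc k) C" "card C = n" by blast
  obtain D where "D \<notin> C" "colex_init m (Suc k) (insert D C)"
    using colex_init_extend[OF C(1)] by blast
  moreover have "finite C" using C by (simp add: colex_init_def)
  ultimately show ?case using C(2) by (intro exI[of _ "insert D C"]) auto
qed

lemma colex_init_level_0: "colex_init m 0 {{}}"
  by (auto simp: colex_init_def level_def)

text \<open>Adding \<open>m\<close> to two sets without \<open>m\<close> raises both codes by
  \<open>2 ^ m\<close>, so their order is preserved.\<close>

lemma colex_init_link:
  assumes "colex_init m (Suc k) C"
  shows "colex_init (Suc m) k (link_fam m C)"
  unfolding colex_init_def
proof (intro conjI ballI impI)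
  have U: "uniform k (link_fam m C)"
    by (rule uniform_link_fam[OF colex_init_uniform[OF assms]])
  then show "finite (link_fam m C)" by (simp add: uniform_def)
  show lev: "link_fam m C \<subseteq> level (Suc m) k"
  proof
    fix B assume B: "B \<in> link_fam m C"
    then have "m \<notin> B" "insert m B \<in> level m (Suc k)"
      using assms by (auto simp: link_fam_def colex_init_def)
    moreover have "B \<subseteq> {Suc m..}"
    proof
      fix i assume "i \<in> B"
      then show "i \<in> {Suc m..}"
        using calculation by (cases "i = m") (auto simp: level_def)
    qed
    ultimately show "B \<in> level (Suc m) k" by (auto simp: level_def)
  qed
  fix A B assume A: "A \<in> link_fam m C" and B: "B \<in> level (Suc m) k" "set_encode B < set_encode A"
  have "A \<in> level (Suc m) k" using lev A by blast
  then have "m \<notin> A" "finite A" "m \<notin> B" "finite B" using B by (auto simp: level_def)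
  then have "set_encode (insert m B) \<le> set_encode (insert m A)" using B(2) by simp
  moreover have "insert m B \<in> level m (Suc k)" using B \<open>m \<notin> B\<close> by (force simp: level_def)
  ultimately have "insert m B \<in> C"
    using colex_init_mem[OF assms, of "insert m A"] A by (auto simp: link_fam_def)
  then show "B \<in> link_fam m C" using \<open>m \<notin> B\<close> by (simp add: link_fam_def)
qed

lemma level_Suc: "level (Suc m) k = del_fam m (level m k)"
proof -
  have "{Suc m..} = {m..} - {m}" by auto
  then have "A \<subseteq> {Suc m..} \<longleftrightarrow> A \<subseteq> {m..} \<and> m \<notin> A" for A
    by (simp only: subset_Diff_insert Diff_empty)
  then show ?thesis by (auto simp: level_def del_fam_def)
qed

lemma colex_init_del:
  assumes "colex_init m k C"
  shows "colex_init (Suc m) k (del_fam m C)"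
  using assms unfolding colex_init_def level_Suc by (auto simp: del_fam_def)

text \<open>Replacing an element by the smaller \<open>m\<close> gives an earlier set, so initial
  segments are already shifted towards \<open>m\<close>.\<close>

lemma colex_init_shadow_del:
  assumes C: "colex_init m k C"
  shows "shadow (del_fam m C) \<subseteq> link_fam m C"
proof
  fix B assume "B \<in> shadow (del_fam m C)"
  then obtain a where a: "a \<notin> B" "insert a B \<in> C" "m \<notin> insert a B"
    by (auto simp: shadow_def del_fam_def)
  have lev: "insert a B \<in> level m k" using C a by (auto simp: colex_init_def)
  then have "m < a" using a by (force simp: level_def)
  have "set_encode (insert m B) < set_encode (insert a B)"
    using lev a \<open>m < a\<close> by (intro set_encode_lessI[of _ _ a]) (auto simp: level_def)
  moreover have "insert m B \<in> level m k" using lev a by (auto simp: level_def)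
  ultimately have "insert m B \<in> C" using C a unfolding colex_init_def by blast
  then show "B \<in> link_fam m C" using a by (simp add: link_fam_def)
qed

section \<open>The Kruskal--Katona theorem\<close>

text \<open>The outer induction on set size serves the links, the inner one on \<open>card F\<close>
  the deletions. Comparing sizes by an inequality lets both hypotheses apply to parts whose sizes
  differ.\<close>

theorem kruskal_katona:
  assumes "uniform k F" and "colex_init m k C" and "card C \<le> card F"
  shows "card (shadow C) \<le> card (shadow F)"
  using assms
proof (induction k arbitrary: F m C)
  case 0
  then show ?case
    using shadow_uniform_0[OF colex_init_uniform[OF "0.prems"(2)]] by simp
next
  case (Suc k)
  note IHk = Suc.IH
  show ?case
    using Suc.prems
  proof (induction "card F" arbitrary: F m C rule: less_induct)
    case less
    note U = less.prems(1) and C = less.prems(2)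
    show ?case
    proof (cases "C = {}")
      case True
      then show ?thesis by (simp add: shadow_def)
    next
      case False
      then have "card C \<noteq> 0" using C by (auto simp: colex_init_def)
      then have "card F \<noteq> 0" using less.prems(3) by simp
      \<comment> \<open>Any element of the type will do, even one outside all sets of
        \<open>F\<close>: the shifts move sets onto it.\<close>
      fix z :: 'a
      obtain G where G: "uniform (Suc k) G" "card G = card F"
        "card (shadow G) \<le> card (shadow F)" "shadow (del_fam z G) \<subseteq> link_fam z G"
        using exists_shifted[OF U] by blast
      let ?L = "link_fam z G" and ?D = "del_fam z G"
      let ?CL = "link_fam m C" and ?CD = "del_fam m C"
      have finG: "finite G" "G \<noteq> {}" using G \<open>card F \<noteq> 0\<close> by (auto simp: uniform_def)
      have finL: "finite ?L" using uniform_link_fam[OF G(1)] by (simp add: uniform_def)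
      have splitG: "card G = card ?L + card ?D" by (rule card_link_del[OF finG(1)])
      have splitC: "card C = card ?CL + card ?CD"
        using C by (intro card_link_del) (simp add: colex_init_def)
      \<comment> \<open>After shifting, the link absorbs the shadow of the deletion, so only the
        links remain to be compared.\<close>
      have shG: "card (shadow G) = card (shadow ?L) + card ?L"
        using card_shadow_split[OF G(1), of z] G(4) by (simp add: Un_absorb2)
      have shC: "card (shadow C) = card (shadow ?CL) + card ?CL"
        using card_shadow_split[OF colex_init_uniform[OF C], of m] colex_init_shadow_del[OF C]
        by (simp add: Un_absorb2)
      have "card ?CL \<le> card ?L"
      proof (rule ccontr)
        \<comment> \<open>Otherwise the deletion of \<open>G\<close> is larger than that of \<open>C\<close>, and already the next set
          after the latter makes its shadow contain the link of \<open>C\<close>.\<close>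
        assume "\<not> card ?CL \<le> card ?L"
        then have lt: "card ?L < card ?CL" by simp
        obtain D where D: "D \<in> level (Suc m) (Suc k)" "D \<notin> ?CD"
          "colex_init (Suc m) (Suc k) (insert D ?CD)"
          using colex_init_extend[OF colex_init_del[OF C]] by blast
        have "finite ?CD" using C by (simp add: colex_init_def del_fam_def)
        then have "card (insert D ?CD) \<le> card ?D"
          using D(2) lt splitC splitG G(2) less.prems(3) by simp
        \<comment> \<open>A nonempty link makes the deletion strictly smaller than \<open>F\<close>,
          as the inner induction requires.\<close>
        moreover have "?L \<noteq> {}"
        proof
          assume "?L = {}"
          then have "?D = {}"
            using G(4) shadow_nonempty[OF uniform_del_fam[OF G(1)], of z] by auto
          then have "card G = 0" using splitG \<open>?L = {}\<close> by simp
          then show False using finG by simp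
        qed
        then have "card ?D < card F"
          using splitG G(2) finL by (simp add: card_gt_0_iff)
        ultimately have "card (shadow (insert D ?CD)) \<le> card (shadow ?D)"
          using less.hyps[OF _ uniform_del_fam[OF G(1)] D(3)] by blast
        also have "\<dots> \<le> card ?L" using G(4) finL by (rule card_mono[rotated])
        finally have "card (shadow (insert D ?CD)) < card ?CL" using lt by simp
        \<comment> \<open>Since \<open>insert m B\<close> lies in \<open>C\<close> and
          \<open>D\<close> does not, \<open>B\<close> precedes \<open>D\<close>; completing
          \<open>B\<close> by its least missing element above \<open>m\<close> does not pass
          \<open>D\<close>.\<close>
        moreover have "?CL \<subseteq> shadow (insert D ?CD)"
        proof
          fix B assume B: "B \<in> ?CL"
          have levB: "B \<in> level (Suc m) k"
            using B colex_init_link[OF C] by (auto simp: colex_init_def)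
          then have finB: "finite B" "m \<notin> B" by (auto simp: level_def)
          have mB: "insert m B \<in> C" using B by (simp add: link_fam_def)
          have Dm: "D \<in> level m (Suc k)" "D \<notin> C"
            using D by (auto simp: level_Suc del_fam_def)
          have "set_encode (insert m B) < set_encode D"
            using colex_init_mem[OF C mB Dm(1)] Dm(2) by (meson leI)
          then have "set_encode B < set_encode D"
            using set_encode_insert_gt[OF finB] by simp
          obtain b where b: "Suc m \<le> b" "b \<notin> B" "\<And>i. Suc m \<le> i \<Longrightarrow> i < b \<Longrightarrow> i \<in> B"
            using exists_least_missing[OF finB(1)] by blast
          have "set_encode (insert b B) \<le> set_encode D"
            using levB D(1) b \<open>set_encode B < set_encode D\<close>
            by (intro set_encode_insert_least[of B "Suc m"]) (auto simp: level_def)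
          moreover have "insert b B \<in> level (Suc m) (Suc k)"
            using levB b by (auto simp: level_def)
          ultimately have "insert b B \<in> insert D ?CD"
            using colex_init_mem[OF D(3), of D] by blast
          then show "B \<in> shadow (insert D ?CD)" using b by (auto simp: shadow_def)
        qed
        then have "card ?CL \<le> card (shadow (insert D ?CD))"
          using finite_shadow[OF colex_init_uniform[OF D(3)]] by (rule card_mono[rotated])
        ultimately show False by simp
      qed
      moreover from this have "card (shadow ?CL) \<le> card (shadow ?L)"
        using IHk[OF uniform_link_fam[OF G(1)] colex_init_link[OF C]] by blast
      ultimately show ?thesis using shG shC G(3) by simp
    qed
  qed
qed

section \<open>Double counting\<close>

text \<open>All \<open>k\<close>-subsets of \<open>{..<w}\<close> precede any set with an element
  \<open>w\<close> or larger. One such set in \<open>C\<close> would force all of them into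
  \<open>C\<close> as well, which is one set too many.\<close>

lemma colex_init_ground:
  assumes C: "colex_init 0 k C" and le: "card C \<le> w choose k" and A: "A \<in> C"
  shows "A \<subseteq> {..<w}"
proof (rule ccontr)
  assume "\<not> A \<subseteq> {..<w}"
  then obtain i where i: "i \<in> A" "w \<le> i" by (meson lessThan_iff not_le subsetI)
  have finA: "finite A" using C A by (auto simp: colex_init_def level_def)
  have "(2::nat) ^ w \<le> 2 ^ i" using i by simp
  also have "\<dots> \<le> set_encode A"
    unfolding set_encode_def using i finA by (intro member_le_sum) auto
  finally have big: "2 ^ w \<le> set_encode A" .
  let ?X = "{B. B \<subseteq> {..<w} \<and> card B = k}"
  have "?X \<subseteq> C"
  proof
    fix B assume "B \<in> ?X"
    then have "B \<in> level 0 k" "set_encode B < 2 ^ w"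
      using set_encode_below finite_subset by (auto simp: level_def)
    then show "B \<in> C" using big by (intro colex_init_mem[OF C A]) auto
  qed
  moreover have "A \<notin> ?X" using i by auto
  ultimately have "?X \<subset> C" using A by blast
  then have "card ?X < card C" using C by (intro psubset_card_mono) (auto simp: colex_init_def)
  then show False using le by (simp add: n_subsets)
qed

text \<open>Removing the element maps pairs of a set and one of its elements injectively to pairs of
  a shadow set and an element of \<open>V\<close> outside it.\<close>

lemma local_LYM:
  assumes U: "uniform (Suc k) G" and V: "finite V" "\<And>A. A \<in> G \<Longrightarrow> A \<subseteq> V"
  shows "Suc k * card G \<le> (card V - k) * card (shadow G)"
proof -
  have sh: "finite B" "card B = k" "B \<subseteq> V" if "B \<in> shadow G" for B
    using that uniform_shadow[OF U] V(2) by (auto simp: uniform_def shadow_def)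
  let ?P = "SIGMA A:G. A" and ?Q = "SIGMA B:shadow G. V - B"
  have "card ?P = Suc k * card G"
    using U by (subst card_SigmaI) (auto simp: uniform_def)
  moreover have "card ?Q = (\<Sum>B\<in>shadow G. card V - k)"
    using V(1) sh finite_shadow[OF U]
    by (subst card_SigmaI) (auto simp: card_Diff_subset intro!: sum.cong)
  moreover have "card ?P \<le> card ?Q"
  proof (rule card_inj_on_le)
    show "inj_on (\<lambda>(A, a). (A - {a}, a)) ?P"
      by (rule inj_onI) auto
    show "(\<lambda>(A, a). (A - {a}, a)) ` ?P \<subseteq> ?Q"
      using shadowI V(2) by fastforce
    show "finite ?Q"
      using V(1) finite_shadow[OF U] by auto
  qed
  ultimately show ?thesis by (simp add: mult.commute)
qed

text \<open>Averaging: the degrees sum to \<open>Suc k * card F\<close>. The bound is multiplied out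
  to avoid division.\<close>

lemma exists_low_degree:
  assumes U: "uniform (Suc k) F" and ne: "F \<noteq> {}"
  obtains x where "x \<in> \<Union>F" "card (link_fam x F) * card (\<Union>F) \<le> Suc k * card F"
proof -
  let ?V = "\<Union>F"
  have finF: "finite F" and finV: "finite ?V" using U by (auto simp: uniform_def)
  have "?V \<noteq> {}" using U ne by (fastforce simp: uniform_def)
  have "(\<Sum>x\<in>?V. card (link_fam x F)) = (\<Sum>x\<in>?V. card {A \<in> F. x \<in> A})"
    by (simp add: card_link_fam)
  also have "\<dots> = (\<Sum>A\<in>F. card {x \<in> ?V. x \<in> A})"
    using finF finV by (rule sum_multicount_gen[symmetric]) simp
  also have "\<dots> = (\<Sum>A\<in>F. Suc k)"
  proof (rule sum.cong[OF refl])
    fix A assume "A \<in> F"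
    then have "{x \<in> ?V. x \<in> A} = A" by auto
    then show "card {x \<in> ?V. x \<in> A} = Suc k" using U \<open>A \<in> F\<close> by (simp add: uniform_def)
  qed
  finally have sum: "(\<Sum>x\<in>?V. card (link_fam x F)) = Suc k * card F" by (simp add: mult.commute)
  show ?thesis
  proof (rule ccontr)
    assume "\<not> thesis"
    then have "\<And>x. x \<in> ?V \<Longrightarrow> Suc k * card F < card (link_fam x F) * card ?V"
      using that by (meson not_le)
    then have "(\<Sum>x\<in>?V. Suc k * card F) < (\<Sum>x\<in>?V. card (link_fam x F) * card ?V)"
      using finV \<open>?V \<noteq> {}\<close> by (intro sum_strict_mono) auto
    then show False by (simp add: sum_distrib_right[symmetric] sum)
  qed
qed

section \<open>Families of minimal shadow\<close>

text \<open>The counterpart of \<open>extremal\<close> for families of facets; competitors live on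
  \<open>nat\<close>, as do the initial segments.\<close>

definition minimal_shadow :: "nat \<Rightarrow> 'a set set \<Rightarrow> bool" where
  "minimal_shadow k F \<longleftrightarrow> uniform k F \<and>
     (\<forall>G :: nat set set. uniform k G \<and> card G = card F \<longrightarrow> card (shadow F) \<le> card (shadow G))"

lemma minimal_shadow_colexI:
  assumes "uniform k F" "colex_init m k C" "card C = card F" "card (shadow F) \<le> card (shadow C)"
  shows "minimal_shadow k F"
  unfolding minimal_shadow_def
proof (intro conjI allI impI)
  fix G :: "nat set set" assume "uniform k G \<and> card G = card F"
  then have "card (shadow C) \<le> card (shadow G)"
    using assms(3) by (intro kruskal_katona[OF _ assms(2)]) auto
  then show "card (shadow F) \<le> card (shadow G)" using assms(4) by simp
qed (rule assms(1))

lemma minimal_shadow_shedding: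
  assumes min: "minimal_shadow (Suc k) F" and two: "2 \<le> card F"
  obtains x where "x \<in> \<Union>F" "link_fam x F \<subseteq> shadow (del_fam x F)" "del_fam x F \<noteq> {}"
    "minimal_shadow k (link_fam x F)" "minimal_shadow (Suc k) (del_fam x F)"
proof -
  have U: "uniform (Suc k) F" using min by (simp add: minimal_shadow_def)
  have finF: "finite F" and ne: "F \<noteq> {}" using U two by (auto simp: uniform_def)
  let ?V = "\<Union>F"
  have finV: "finite ?V" using U by (auto simp: uniform_def)
  obtain x where x: "x \<in> ?V" and deg: "card (link_fam x F) * card ?V \<le> Suc k * card F"
    using exists_low_degree[OF U ne] by blast
  let ?L = "link_fam x F" and ?D = "del_fam x F"
  have UL: "uniform k ?L" and UD: "uniform (Suc k) ?D"
    using U by (rule uniform_link_fam, rule uniform_del_fam)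
  have split: "card F = card ?L + card ?D" by (rule card_link_del[OF finF])
  \<comment> \<open>Two distinct sets of equal size span a further vertex. The strictness rules out
    an empty deletion and later allows cancelling \<open>card ?V - Suc k\<close>.\<close>
  have "Suc k < card ?V"
  proof -
    obtain A B where AB: "A \<in> F" "B \<in> F" "A \<noteq> B"
      using two by (meson card_2_iff' obtain_subset_with_card_n subsetD)
    have c: "card A = Suc k" "card B = Suc k" "finite B" using U AB by (auto simp: uniform_def)
    have "A \<noteq> ?V"
    proof
      assume "A = ?V"
      then have "B \<subseteq> A" "finite A" using AB finV by auto
      then show False using card_subset_eq[of A B] c AB by simp
    qed
    then have "A \<subset> ?V" using AB by blast
    then show ?thesis using psubset_card_mono[OF finV] c by metis
  qed
  have Dne: "?D \<noteq> {}"
  proof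
    assume "?D = {}"
    then have "card F * card ?V \<le> card F * Suc k" using split deg by (simp add: mult.commute)
    then have "card ?V \<le> Suc k" using two mult_le_cancel1 by (metis not_numeral_le_zero gr0I)
    then show False using \<open>Suc k < card ?V\<close> by simp
  qed
  obtain C where C: "colex_init 0 (Suc k) C" "card C = card ?D"
    using colex_init_exists by blast
  have UC: "uniform (Suc k) C" using C(1) by (rule colex_init_uniform)
  \<comment> \<open>The deletion lives on \<open>?V - {x}\<close>, so it is small enough for
    \<open>C\<close> to fit into \<open>card ?V - 1\<close> points.\<close>
  have "card ?D \<le> card {B. B \<subseteq> ?V - {x} \<and> card B = Suc k}"
    using finV U by (intro card_mono) (auto simp: del_fam_def uniform_def)
  then have "card C \<le> (card ?V - 1) choose Suc k"
    using finV x C(2) by (simp add: n_subsets)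
  then have ground: "A \<subseteq> {..<card ?V - 1}" if "A \<in> C" for A
    using colex_init_ground[OF C(1)] that by blast
  have "card ?L * (card ?V - Suc k) \<le> Suc k * card ?D"
  proof -
    have "card ?L * (card ?V - Suc k) = card ?L * card ?V - card ?L * Suc k"
      by (simp add: diff_mult_distrib2)
    also have "\<dots> \<le> Suc k * card F - card ?L * Suc k" using deg by (rule diff_le_mono)
    also have "\<dots> = Suc k * card ?D" unfolding split by (simp add: algebra_simps)
    finally show ?thesis .
  qed
  \<comment> \<open>On \<open>card ?V - 1\<close> points the local LYM factor is
    \<open>card ?V - 1 - k\<close>, the same positive factor as on the left.\<close>
  also have "\<dots> \<le> (card ?V - Suc k) * card (shadow C)"
    using local_LYM[OF UC _ ground] C(2) by simp
  finally have "card ?L \<le> card (shadow C)"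
    using \<open>Suc k < card ?V\<close> by (simp add: mult.commute)
  then obtain T where T: "colex_init 0 k T" "card T = card ?L" "T \<subseteq> shadow C"
  proof -
    have sh: "colex_init 0 k (shadow C)" using C(1) by (rule colex_init_shadow)
    have "\<exists>T. colex_init 0 k T \<and> card T = card ?L"
    proof (cases k)
      case (Suc k')
      then show ?thesis using colex_init_exists by blast
    next
      case 0
      \<comment> \<open>A segment of empty sets has at most one member, so for \<open>k = 0\<close>
        the link must be identified as \<open>{{}}\<close>.\<close>
      have "?L \<noteq> {}" using x U by (auto simp: link_fam_def) (metis insert_Diff Diff_iff singletonI)
      then have "?L = {{}}" using UL 0 by (auto simp: uniform_def)
      then show ?thesis using colex_init_level_0 0 by (intro exI[of _ "{{}}"]) simp
    qed
    then obtain T where "colex_init 0 k T" "card T = card ?L" by blast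
    then show ?thesis
      using that colex_init_mono[OF _ sh] \<open>card ?L \<le> card (shadow C)\<close> by simp
  qed
  have UT: "uniform k T" using T(1) by (rule colex_init_uniform)
  have KT: "card (shadow T) \<le> card (shadow ?L)"
    using kruskal_katona[OF UL T(1)] T(2) by simp
  have KC: "card (shadow C) \<le> card (shadow ?D)"
    using kruskal_katona[OF UD C(1)] C(2) by simp
  \<comment> \<open>\<open>C\<close>, and with it \<open>T\<close>, lives on
    \<open>{..<card ?V - 1}\<close>, so this vertex is new.\<close>
  define y where "y = card ?V"
  define H where "H = C \<union> insert y ` T"
  have yC: "y \<notin> A" if "A \<in> C" for A using ground[OF that] by (auto simp: y_def)
  have yT: "y \<notin> A" if "A \<in> T" for A using that T(3) yC by (auto simp: shadow_def)
  have LH: "link_fam y H = T"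
    using yC yT unfolding link_fam_def H_def by (auto simp: insert_ident)
  have DH: "del_fam y H = C"
    using yC unfolding del_fam_def H_def by auto
  have UH: "uniform (Suc k) H"
    using UC UT yT by (auto simp: H_def uniform_def)
  have "card H = card F"
    using card_link_del[of H y] UH split T(2) C(2) by (simp add: LH DH uniform_def)
  then have "card (shadow F) \<le> card (shadow H)"
    using min UH by (simp add: minimal_shadow_def)
  also have "\<dots> = card (shadow T) + card (shadow C)"
    using card_shadow_split[OF UH, of y] T(3) by (simp add: LH DH Un_absorb1)
  finally have le: "card (shadow ?L) + card (?L \<union> shadow ?D) \<le> card (shadow T) + card (shadow C)"
    using card_shadow_split[OF U, of x] by simp
  have fin: "finite (?L \<union> shadow ?D)"
    using UL finite_shadow[OF UD] by (simp add: uniform_def)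
  then have mono: "card (shadow ?D) \<le> card (?L \<union> shadow ?D)" by (intro card_mono) auto
  \<comment> \<open>By \<open>KT\<close> and \<open>KC\<close> the right side of \<open>le\<close>
    is at most \<open>card (shadow ?L) + card (shadow ?D)\<close>. The same squeeze, one summand at
    a time, gives minimality of \<open>?L\<close> and \<open>?D\<close>.\<close>
  have "shadow ?D = ?L \<union> shadow ?D"
    using fin le KT KC mono by (intro card_subset_eq) auto
  then have "?L \<subseteq> shadow ?D" by blast
  moreover have "minimal_shadow k ?L"
    using minimal_shadow_colexI[OF UL T(1,2)] le KC mono by simp
  moreover have "minimal_shadow (Suc k) ?D"
    using minimal_shadow_colexI[OF UD C] le KT mono by simp
  ultimately show ?thesis using that x Dne by blast
qed

section \<open>Complexes generated by uniform families\<close>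

text \<open>The downward closure. For empty \<open>F\<close> it lacks even the empty face, hence the
  conditions \<open>F \<noteq> {}\<close> below.\<close>

definition generated :: "'a set set \<Rightarrow> 'a set set" where
  "generated F = {B. \<exists>A\<in>F. B \<subseteq> A}"

lemma simplicial_complex_generated:
  assumes "uniform k F" and "F \<noteq> {}"
  shows "simplicial_complex (generated F)"
proof -
  have "generated F = (\<Union>A\<in>F. Pow A)" by (auto simp: generated_def)
  then have "finite (generated F)" using assms(1) by (simp add: uniform_def)
  then show ?thesis
    using assms unfolding simplicial_complex_def generated_def uniform_def
    by (auto intro: finite_subset)
qed

lemma facets_generated:
  assumes "uniform k F"
  shows "facets (generated F) = F"
proof -
  have "A = B" if "A \<in> F" "B \<in> F" "A \<subseteq> B" for A B
    using that assms card_subset_eq[of B A] by (simp add: uniform_def)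
  then show ?thesis
    unfolding facets_def generated_def by blast
qed

lemma pure_generated: "uniform k F \<Longrightarrow> pure (generated F)"
  unfolding pure_def by (simp add: facets_generated) (simp add: uniform_def face_dim_def)

lemma link_generated: "link (generated F) x = generated (link_fam x F)"
proof
  show "link (generated F) x \<subseteq> generated (link_fam x F)"
  proof
    fix B assume "B \<in> link (generated F) x"
    then obtain A where "x \<notin> B" "A \<in> F" "insert x B \<subseteq> A"
      by (auto simp: link_def generated_def)
    then have "B \<subseteq> A - {x}" "A - {x} \<in> link_fam x F"
      by (auto simp: link_fam_def insert_absorb)
    then show "B \<in> generated (link_fam x F)" by (auto simp: generated_def)
  qed
  show "generated (link_fam x F) \<subseteq> link (generated F) x"
    unfolding generated_def link_fam_def link_def by auto (metis subset_insertI2)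
qed

text \<open>By the inclusion, what remains of a facet through \<open>x\<close> lies in a facet
  avoiding \<open>x\<close>, so the deletion gains no smaller facets.\<close>

lemma deletion_generated:
  assumes "link_fam x F \<subseteq> shadow (del_fam x F)"
  shows "deletion (generated F) x = generated (del_fam x F)"
proof
  show "deletion (generated F) x \<subseteq> generated (del_fam x F)"
  proof
    fix B assume "B \<in> deletion (generated F) x"
    then obtain A where A: "A \<in> F" "B \<subseteq> A" "x \<notin> B"
      by (auto simp: deletion_def generated_def)
    show "B \<in> generated (del_fam x F)"
    proof (cases "x \<in> A")
      case False
      then show ?thesis using A by (auto simp: generated_def del_fam_def)
    next
      case True
      then have "A - {x} \<in> shadow (del_fam x F)"
        using A assms by (auto simp: link_fam_def insert_absorb)
      then obtain a where "insert a (A - {x}) \<in> del_fam x F" by (auto simp: shadow_def)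
      moreover have "B \<subseteq> insert a (A - {x})" using A by auto
      ultimately show ?thesis unfolding generated_def by blast
    qed
  qed
  show "generated (del_fam x F) \<subseteq> deletion (generated F) x"
    unfolding generated_def del_fam_def deletion_def by auto
qed

lemma vertex_decomposable_simplex:
  assumes "finite A"
  shows "vertex_decomposable (generated {A})"
  using assms
proof (induction A)
  case empty
  have "generated {{}} = {{} :: 'a set}" by (auto simp: generated_def)
  then show ?case by (simp add: vertex_decomposable.empty)
next
  case (insert x A)
  have U: "uniform (card (insert x A)) {insert x A}" "uniform (card A) {A}"
    using insert by (auto simp: uniform_def)
  have "link_fam x {insert x A} = {A}"
    using insert by (auto simp: link_fam_def insert_ident)
  then have link: "link (generated {insert x A}) x = generated {A}"
    by (simp add: link_generated)
  \<comment> \<open>No generator avoids \<open>x\<close>, so \<open>deletion_generated\<close> does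
    not apply and the deletion is computed directly.\<close>
  have del: "deletion (generated {insert x A}) x = generated {A}"
    using insert by (auto simp: deletion_def generated_def)
  show ?case
  proof (rule vertex_decomposable.decompose[of _ x])
    show "x \<in> vertices (generated {insert x A})" by (simp add: vertices_def generated_def)
  qed (use U simplicial_complex_generated[OF U(1)] in
      \<open>simp_all add: link del insert.IH pure_generated\<close>)
qed

text \<open>Induction on the number of vertices, which drops for both link and deletion; a single
  facet gives a simplex.\<close>

lemma vertex_decomposable_generated:
  assumes "minimal_shadow k F" and "F \<noteq> {}"
  shows "vertex_decomposable (generated F)"
  using assms
proof (induction "card (\<Union>F)" arbitrary: k F rule: less_induct)
  case less
  have U: "uniform k F" using less.prems by (simp add: minimal_shadow_def)
  then have fin: "finite F" "finite (\<Union>F)" by (auto simp: uniform_def)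
  show ?case
  proof (cases "2 \<le> card F")
    case False
    moreover have "card F \<noteq> 0" using fin less.prems(2) by simp
    ultimately have "card F = 1" by linarith
    then obtain A where "F = {A}" using card_1_singletonE by blast
    then show ?thesis using U by (simp add: uniform_def vertex_decomposable_simplex)
  next
    case True
    have "k \<noteq> 0"
    proof
      assume "k = 0"
      then have "F \<subseteq> {{}}" using U by (auto simp: uniform_def)
      then show False using True card_mono[of "{{}}" F] by simp
    qed
    then obtain k' where k: "k = Suc k'" using not0_implies_Suc by blast
    obtain x where x: "x \<in> \<Union>F" "link_fam x F \<subseteq> shadow (del_fam x F)" "del_fam x F \<noteq> {}"
      "minimal_shadow k' (link_fam x F)" "minimal_shadow (Suc k') (del_fam x F)"
      using minimal_shadow_shedding[OF less.prems(1)[unfolded k] True] by blast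
    have "\<Union>(link_fam x F) \<subset> \<Union>F" "\<Union>(del_fam x F) \<subset> \<Union>F"
      using x(1) by (auto simp: link_fam_def del_fam_def)
    then have smaller: "card (\<Union>(link_fam x F)) < card (\<Union>F)" "card (\<Union>(del_fam x F)) < card (\<Union>F)"
      using fin by (auto intro: psubset_card_mono)
    have "link_fam x F \<noteq> {}" using x(1) insert_link_fam[of x F] by auto
    show ?thesis
    proof (rule vertex_decomposable.decompose[of _ x])
      show "simplicial_complex (generated F)" "pure (generated F)"
        using U less.prems(2) simplicial_complex_generated pure_generated by blast+
      show "x \<in> vertices (generated F)" using x(1) by (auto simp: vertices_def generated_def)
      show "pure (link (generated F) x)" "vertex_decomposable (link (generated F) x)"
        using x(4) less.hyps[OF smaller(1) x(4) \<open>link_fam x F \<noteq> {}\<close>] pure_generated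
        by (auto simp: link_generated minimal_shadow_def)
      show "pure (deletion (generated F) x)" "vertex_decomposable (deletion (generated F) x)"
        using x(5) less.hyps[OF smaller(2) x(5,3)] pure_generated
        by (auto simp: deletion_generated[OF x(2)] minimal_shadow_def)
    qed
  qed
qed

section \<open>From extremal complexes to families of minimal shadow\<close>

lemma generated_facets:
  assumes "simplicial_complex \<Delta>"
  shows "generated (facets \<Delta>) = \<Delta>"
proof
  show "generated (facets \<Delta>) \<subseteq> \<Delta>"
    using assms unfolding simplicial_complex_def generated_def facets_def by blast
  show "\<Delta> \<subseteq> generated (facets \<Delta>)"
  proof
    fix B assume "B \<in> \<Delta>"
    moreover have "finite \<Delta>" using assms by (simp add: simplicial_complex_def)
    ultimately obtain A where "A \<in> \<Delta>" "B \<subseteq> A" "\<forall>C\<in>\<Delta>. A \<subseteq> C \<longrightarrow> A = C"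
      using finite_has_maximal2[of \<Delta> B] by blast
    then show "B \<in> generated (facets \<Delta>)" by (auto simp: generated_def facets_def)
  qed
qed

text \<open>Integer dimensions keep \<open>k = 0\<close> meaningful: there are no faces of dimension
  -2, and the shadow is empty.\<close>

lemma faces_of_dim_generated:
  assumes "uniform k F"
  shows "faces_of_dim (int k - 1) (generated F) = F"
    and "faces_of_dim (int k - 2) (generated F) = shadow F"
proof -
  have "B = A" if "A \<in> F" "B \<subseteq> A" "card B = k" for A B
    using that assms card_subset_eq[of A B] by (simp add: uniform_def)
  then show "faces_of_dim (int k - 1) (generated F) = F"
    using assms unfolding faces_of_dim_def generated_def face_dim_def uniform_def by auto
  have "B \<in> shadow F" if "A \<in> F" "B \<subseteq> A" "Suc (card B) = k" for A B
  proof -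
    have "finite A" "card A = k" using that assms by (auto simp: uniform_def)
    moreover from this have "finite B" using that finite_subset by blast
    ultimately have "card (A - B) = 1" using that by (auto simp: card_Diff_subset)
    then obtain a where "A - B = {a}" using card_1_singletonE by blast
    then have "a \<notin> B" "insert a B = A" using that by auto
    then show ?thesis using that by (auto simp: shadow_def)
  qed
  moreover have "face_dim B = int k - 2 \<longleftrightarrow> Suc (card B) = k" for B :: "'a set"
    by (auto simp: face_dim_def)
  moreover have "Suc (card B) = k \<and> B \<in> generated F" if "B \<in> shadow F" for B
  proof -
    obtain a where a: "a \<notin> B" "insert a B \<in> F" using \<open>B \<in> shadow F\<close> by (auto simp: shadow_def)
    then have "finite (insert a B)" "card (insert a B) = k" using assms by (auto simp: uniform_def)
    then show ?thesis using a by (auto simp: generated_def)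
  qed
  ultimately show "faces_of_dim (int k - 2) (generated F) = shadow F"
    unfolding faces_of_dim_def by (auto simp: generated_def)
qed

lemma complex_dim_generated:
  assumes "uniform k F" and "F \<noteq> {}"
  shows "complex_dim (generated F) = int k - 1"
  unfolding complex_dim_def
proof (rule Max_eqI)
  show "finite (face_dim ` generated F)"
    using simplicial_complex_generated[OF assms] by (simp add: simplicial_complex_def)
  show "int k - 1 \<in> face_dim ` generated F"
    using assms by (force simp: generated_def face_dim_def uniform_def)
  fix i assume "i \<in> face_dim ` generated F"
  then obtain A B where "A \<in> F" "B \<subseteq> A" "i = int (card B) - 1"
    by (auto simp: generated_def face_dim_def)
  then show "i \<le> int k - 1"
    using assms(1) card_mono[of A B] by (simp add: uniform_def)
qed

theorem theorem5:
  fixes \<Delta> :: "'a set set"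
  assumes "extremal \<Delta>"
  shows "vertex_decomposable \<Delta>"
proof -
  let ?F = "facets \<Delta>"
  have sc: "simplicial_complex \<Delta>" and pure: "pure \<Delta>"
    using assms by (auto simp: extremal_def)
  have gen: "generated ?F = \<Delta>" using sc by (rule generated_facets)
  then have ne: "?F \<noteq> {}" using sc by (auto simp: generated_def simplicial_complex_def)
  then obtain A where A: "A \<in> ?F" by blast
  have U: "uniform (card A) ?F"
    unfolding uniform_def
  proof (intro conjI ballI)
    show "finite ?F" using sc by (simp add: facets_def simplicial_complex_def)
    fix B assume B: "B \<in> ?F"
    then show "finite B" using sc by (simp add: facets_def simplicial_complex_def)
    have "face_dim B = face_dim A" using pure A B unfolding pure_def by blast
    then show "card B = card A" by (simp add: face_dim_def)
  qed
  have dim: "complex_dim \<Delta> = int (card A) - 1"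
    using complex_dim_generated[OF U ne] by (simp add: gen)
  have "minimal_shadow (card A) ?F"
    unfolding minimal_shadow_def
  proof (intro conjI allI impI U)
    fix G :: "nat set set" assume G: "uniform (card A) G \<and> card G = card ?F"
    have "card ?F \<noteq> 0" using U ne by (simp add: uniform_def)
    then have "G \<noteq> {}" using G by auto
    \<comment> \<open>The competing family \<open>G\<close> becomes a competing complex by
      generation: its top faces are \<open>G\<close> and those one dimension lower are
      \<open>shadow G\<close>.\<close>
    have "card (faces_of_dim (complex_dim \<Delta> - 1) \<Delta>)
        \<le> card (faces_of_dim (complex_dim \<Delta> - 1) (generated G))"
      using assms G faces_of_dim_generated(1)[of "card A" G]
        simplicial_complex_generated[OF _ \<open>G \<noteq> {}\<close>]
      unfolding extremal_def Let_def dim by auto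
    then show "card (shadow ?F) \<le> card (shadow G)"
      using faces_of_dim_generated(2)[OF U] faces_of_dim_generated(2)[of "card A" G] G
      by (simp add: dim gen)
  qed
  then show ?thesis using vertex_decomposable_generated ne gen by metis
qed

end
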